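(* Let $n\ge 0$ and let $\mathcal M_n^*$ be the dual of the matroid $\mathcal M_n$. For a subset $X\subseteq[n]^\to$ of the ground set and $0\le i<n$, let $X_{i\to}=\{e\in X\mid e \text{ has source } i\}$. Then $X$ is independent in $\mathcal M_n^*$ if and only if $|X_{i\to}|<n-i$ for each $0\le i<n$. Moreover, $X$ is a basis set of $\mathcal M_n^*$ if and only if $|X_{i\to}|=n-i-1$ for each $0\le i<n$.
   Context: $[n]$ denotes the linearly ordered set $\{0<1<\dots<n\}$, with meet $i\wedge j=\min(i,j)$. $[n]^\to$ denotes the set of nontrivial edges of $[n]$, i.e. pairs $(i\to j)$ with $0\le i<j\le n$; the source of the edge $(i\to j)$ is $i$. A transfer system on $[n]$ is a partial order $T$ on the set $[n]$ that is contained in $\le$ (reflexive, transitive, and $i\,T\,j$ implies $i\le j$) and is closed under restriction: if $i\,T\,j$ and $k\in[n]$, then $(i\wedge k)\,T\,(j\wedge k)$. For every $S\subseteq[n]^\to$ there is a smallest transfer system containing $S$, called the transfer system generated by $S$. A set $S\subseteq [n]^\to$ is a minimal generating set if no proper subset of $S$ generates the same transfer system as $S$; $\mathrm{MGS}([n])\subseteq\mathcal P([n]^\to)$ denotes the collection of all minimal generating sets (of all transfer systems on $[n]$). $\mathcal M_n=([n]^\to,\mathrm{MGS}([n]))$ is the matroid with ground set $[n]^\to$ whose independent sets are the elements of $\mathrm{MGS}([n])$ (it is a fact that this pair is a matroid). A basis set of a matroid is a maximal independent set. The dual $M^*$ of a matroid $M$ is the matroid with the same ground set as $M$, whose basis sets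 are the complements of the basis sets of $M$ (so its independent sets are the subsets of such complements). *)

theory Defs
  imports Main
begin

section \<open>Transfer systems on the chain \<open>0 < 1 < \<dots> < n\<close>\<close>

text \<open>The carrier \<open>[n]\<close> is \<open>{0..n}\<close>, and an edge from \<open>i\<close> to \<open>j\<close> is the pair \<open>(i, j)\<close>.\<close>

definition chain_edges :: "nat \<Rightarrow> (nat \<times> nat) set" where
  "chain_edges n = {(i, j). i < j \<and> j \<le> n}"

definition transfer_system :: "nat \<Rightarrow> nat rel \<Rightarrow> bool" where
  "transfer_system n T \<longleftrightarrow>
     partial_order_on {0..n} T \<and>
     (\<forall>i j. (i, j) \<in> T \<longrightarrow> i \<le> j) \<and>
     (\<forall>i j k. (i, j) \<in> T \<longrightarrow> k \<le> n \<longrightarrow> (min i k, min j k) \<in> T)"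

definition generated :: "nat \<Rightarrow> (nat \<times> nat) set \<Rightarrow> nat rel" where
  "generated n S = \<Inter> {T. transfer_system n T \<and> S \<subseteq> T}"

definition minimal_generating_set :: "nat \<Rightarrow> (nat \<times> nat) set \<Rightarrow> bool" where
  "minimal_generating_set n S \<longleftrightarrow>
     S \<subseteq> chain_edges n \<and> (\<forall>S'. S' \<subset> S \<longrightarrow> generated n S' \<noteq> generated n S)"

definition MGS :: "nat \<Rightarrow> (nat \<times> nat) set set" where
  "MGS n = {S. minimal_generating_set n S}"

lemma transfer_systemI:
  assumes "T \<subseteq> {0..n} \<times> {0..n}" "\<And>i. i \<le> n \<Longrightarrow> (i, i) \<in> T"
    and "\<And>i j k. (i, j) \<in> T \<Longrightarrow> (j, k) \<in> T \<Longrightarrow> (i, k) \<in> T"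
    and le: "\<And>i j. (i, j) \<in> T \<Longrightarrow> i \<le> j"
    and "\<And>i j k. (i, j) \<in> T \<Longrightarrow> k \<le> n \<Longrightarrow> (min i k, min j k) \<in> T"
  shows "transfer_system n T"
proof -
  have "trans T" using assms(3) by (rule transI)
  moreover have "antisym T" by (rule antisymI) (simp add: le le_antisym)
  ultimately show ?thesis
    using assms by (auto simp: transfer_system_def partial_order_on_def preorder_on_def refl_on_def)
qed

lemma transfer_systemD:
  assumes "transfer_system n T"
  shows "T \<subseteq> {0..n} \<times> {0..n}" "\<And>i. i \<le> n \<Longrightarrow> (i, i) \<in> T"
    and "\<And>i j k. (i, j) \<in> T \<Longrightarrow> (j, k) \<in> T \<Longrightarrow> (i, k) \<in> T"
    and "\<And>i j. (i, j) \<in> T \<Longrightarrow> i \<le> j"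
    and "\<And>i j k. (i, j) \<in> T \<Longrightarrow> k \<le> n \<Longrightarrow> (min i k, min j k) \<in> T"
proof -
  have p: "T \<subseteq> {0..n} \<times> {0..n}" "refl_on {0..n} T" "trans T"
    using assms by (simp_all add: transfer_system_def partial_order_on_def preorder_on_def)
  show "T \<subseteq> {0..n} \<times> {0..n}" by (rule p(1))
  show "(i, i) \<in> T" if "i \<le> n" for i using p(2) that by (simp add: refl_on_def)
  show "(i, k) \<in> T" if "(i, j) \<in> T" "(j, k) \<in> T" for i j k using p(3) that by (rule transD)
  show "i \<le> j" if "(i, j) \<in> T" for i j using assms that by (simp add: transfer_system_def)
  show "(min i k, min j k) \<in> T" if "(i, j) \<in> T" "k \<le> n" for i j k
    using assms that by (simp add: transfer_system_def)
qed

lemma transfer_system_le: "transfer_system n {(i, j). i \<le> j \<and> j \<le> n}"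
  by (rule transfer_systemI) (auto simp: min_def)

lemma generated_least: "transfer_system n T \<Longrightarrow> S \<subseteq> T \<Longrightarrow> generated n S \<subseteq> T"
  by (auto simp: generated_def)

lemma subset_generated: "S \<subseteq> generated n S"
  by (auto simp: generated_def)

lemma transfer_system_generated:
  assumes "S \<subseteq> chain_edges n"
  shows "transfer_system n (generated n S)"
proof (rule transfer_systemI)
  have "S \<subseteq> {(i, j). i \<le> j \<and> j \<le> n}"
    using assms by (auto simp: chain_edges_def)
  then have sub: "generated n S \<subseteq> {(i, j). i \<le> j \<and> j \<le> n}"
    using transfer_system_le by (rule generated_least[rotated])
  then show "generated n S \<subseteq> {0..n} \<times> {0..n}" by auto
  show "i \<le> j" if "(i, j) \<in> generated n S" for i j using that sub by auto
  show "(i, i) \<in> generated n S" if "i \<le> n" for i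
    using that by (auto simp: generated_def intro: transfer_systemD(2))
  show "(i, k) \<in> generated n S" if "(i, j) \<in> generated n S" "(j, k) \<in> generated n S" for i j k
    using that unfolding generated_def by (blast intro: transfer_systemD(3))
  show "(min i k, min j k) \<in> generated n S" if "(i, j) \<in> generated n S" "k \<le> n" for i j k
    using that unfolding generated_def by (blast intro: transfer_systemD(5))
qed

section \<open>Matroids and duality\<close>

text \<open>A matroid is a pair of a ground set and its family of independent sets.\<close>

definition matroid :: "'a set \<times> 'a set set \<Rightarrow> bool" where
  "matroid M \<longleftrightarrow>
     finite (fst M) \<and> snd M \<subseteq> Pow (fst M) \<and> {} \<in> snd M \<and>
     (\<forall>A B. A \<in> snd M \<longrightarrow> B \<subseteq> A \<longrightarrow> B \<in> snd M) \<and>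
     (\<forall>A B. A \<in> snd M \<longrightarrow> B \<in> snd M \<longrightarrow> card A < card B \<longrightarrow>
        (\<exists>x\<in>B - A. insert x A \<in> snd M))"

definition independent_set :: "'a set \<times> 'a set set \<Rightarrow> 'a set \<Rightarrow> bool" where
  "independent_set M X \<longleftrightarrow> X \<in> snd M"

definition basis_set :: "'a set \<times> 'a set set \<Rightarrow> 'a set \<Rightarrow> bool" where
  "basis_set M B \<longleftrightarrow> independent_set M B \<and> (\<forall>C. independent_set M C \<longrightarrow> B \<subseteq> C \<longrightarrow> C = B)"

definition dual_matroid :: "'a set \<times> 'a set set \<Rightarrow> 'a set \<times> 'a set set" where
  "dual_matroid M = (fst M, {X. \<exists>B. basis_set M B \<and> X \<subseteq> fst M - B})"

lemma basis_set_dual: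
  assumes "matroid M"
  shows "basis_set (dual_matroid M) X \<longleftrightarrow> (\<exists>B. basis_set M B \<and> X = fst M - B)"
proof
  assume X: "basis_set (dual_matroid M) X"
  then obtain B where B: "basis_set M B" "X \<subseteq> fst M - B"
    unfolding basis_set_def[of "dual_matroid M"] by (auto simp: independent_set_def dual_matroid_def)
  moreover have "independent_set (dual_matroid M) (fst M - B)"
    using B(1) by (auto simp: independent_set_def dual_matroid_def)
  ultimately show "\<exists>B. basis_set M B \<and> X = fst M - B"
    using X unfolding basis_set_def[of "dual_matroid M"] by metis
next
  have sub: "C \<subseteq> fst M" if "basis_set M C" for C
    using that assms by (auto simp: basis_set_def independent_set_def matroid_def)
  assume "\<exists>B. basis_set M B \<and> X = fst M - B"
  then obtain B where B: "basis_set M B" "X = fst M - B" by blast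
  have "Y = X" if Y: "independent_set (dual_matroid M) Y" "X \<subseteq> Y" for Y
  proof -
    obtain C where C: "basis_set M C" "Y \<subseteq> fst M - C"
      using Y(1) by (auto simp: independent_set_def dual_matroid_def)
    have "C \<subseteq> B" using B(2) C(2) Y(2) sub[OF C(1)] by blast
    then have "B = C" using B(1) C(1) unfolding basis_set_def by blast
    then show ?thesis using B(2) C(2) Y(2) by blast
  qed
  moreover have "independent_set (dual_matroid M) X"
    using B by (auto simp: independent_set_def dual_matroid_def)
  ultimately show "basis_set (dual_matroid M) X" by (simp add: basis_set_def)
qed

section \<open>The matroid of minimal generating sets\<close>

definition transfer_matroid :: "nat \<Rightarrow> (nat \<times> nat) set \<times> (nat \<times> nat) set set" where
  "transfer_matroid n = (chain_edges n, MGS n)"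

definition with_source :: "(nat \<times> nat) set \<Rightarrow> nat \<Rightarrow> (nat \<times> nat) set" where
  "with_source X i = {e \<in> X. fst e = i}"

lemma finite_chain_edges: "finite (chain_edges n)"
  by (rule finite_subset[of _ "{0..n} \<times> {0..n}"]) (auto simp: chain_edges_def)

lemma source_of_generated:
  assumes "S \<subseteq> chain_edges n" "(i, j) \<in> generated n S" "i < j"
  shows "i \<in> fst ` S"
proof -
  let ?T = "{(a, b). a \<le> b \<and> b \<le> n \<and> (a < b \<longrightarrow> (\<exists>c. (a, c) \<in> S))}"
  have "transfer_system n ?T"
    by (rule transfer_systemI) (auto simp: min_def split: if_splits)
  moreover have "S \<subseteq> ?T" using assms(1) by (force simp: chain_edges_def)
  ultimately have "generated n S \<subseteq> ?T" by (rule generated_least)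
  then show ?thesis using assms(2,3) by force
qed

lemma MGS_iff_inj: "S \<in> MGS n \<longleftrightarrow> S \<subseteq> chain_edges n \<and> inj_on fst S"
proof (intro iffI conjI)
  assume S: "S \<in> MGS n"
  then show sub: "S \<subseteq> chain_edges n" by (simp add: MGS_def minimal_generating_set_def)
  have no: False if e: "(i, j) \<in> S" "(i, k) \<in> S" "j < k" for i j k
  proof -
    let ?S = "S - {(i, j)}"
    have ts: "transfer_system n (generated n ?S)"
      using sub by (intro transfer_system_generated) auto
    have "(i, k) \<in> generated n ?S" using e subset_generated[of ?S n] by auto
    moreover have "i < j" "j \<le> n" using e sub by (auto simp: chain_edges_def)
    ultimately have "(i, j) \<in> generated n ?S"
      using transfer_systemD(5)[OF ts, of i k j] e(3) by (simp add: min_def)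
    then have "S \<subseteq> generated n ?S" using subset_generated[of ?S n] by auto
    then have "generated n S \<subseteq> generated n ?S" using ts by (rule generated_least[rotated])
    moreover have "generated n ?S \<subseteq> generated n S" unfolding generated_def by blast
    ultimately have "generated n ?S = generated n S" by simp
    moreover have "?S \<subset> S" using e by auto
    ultimately show False using S by (auto simp: MGS_def minimal_generating_set_def)
  qed
  show "inj_on fst S"
  proof (rule inj_onI)
    fix x y assume xy: "x \<in> S" "y \<in> S" "fst x = fst y"
    obtain i j k where x: "x = (i, j)" and y: "y = (i, k)" using xy(3) by (cases x; cases y) auto
    have "\<not> j < k" using no xy unfolding x y by blast
    moreover have "\<not> k < j" using no xy unfolding x y by blast
    ultimately show "x = y" using x y by simp
  qed
next
  assume S: "S \<subseteq> chain_edges n \<and> inj_on fst S"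
  have "generated n S' \<noteq> generated n S" if sub: "S' \<subset> S" for S'
  proof
    assume eq: "generated n S' = generated n S"
    obtain e where e: "e \<in> S" "e \<notin> S'" using sub by blast
    have "e \<in> generated n S'" using e(1) eq subset_generated by blast
    moreover have "fst e < snd e" using e(1) S by (auto simp: chain_edges_def)
    ultimately have "fst e \<in> fst ` S'"
      using source_of_generated[of S' n "fst e" "snd e"] S sub by auto
    then obtain f where "f \<in> S'" "fst e = fst f" by blast
    then show False using e S sub by (metis inj_onD psubsetD)
  qed
  then show "S \<in> MGS n" using S by (auto simp: MGS_def minimal_generating_set_def)
qed

lemma matroid_transfer_matroid: "matroid (transfer_matroid n)"
proof -
  have "\<exists>x\<in>B - A. insert x A \<in> MGS n"
    if A: "A \<in> MGS n" and B: "B \<in> MGS n" and lt: "card A < card B" for A B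
  proof -
    have fin: "finite A" using A finite_chain_edges finite_subset MGS_iff_inj by metis
    have "card (fst ` A) < card (fst ` B)" using A B lt by (simp add: MGS_iff_inj card_image)
    then have "\<not> fst ` B \<subseteq> fst ` A" using fin card_mono[of "fst ` A" "fst ` B"] by auto
    then obtain x where x: "x \<in> B" "fst x \<notin> fst ` A" by blast
    then have "insert x A \<in> MGS n" using A B unfolding MGS_iff_inj by auto
    then show ?thesis using x by blast
  qed
  then show ?thesis
    unfolding matroid_def transfer_matroid_def
    using finite_chain_edges by (auto simp: MGS_iff_inj intro: inj_on_subset)
qed

end

theory Submission
  imports Defs
begin

text \<open>
  Independence in \<open>\<M>\<^sub>n\<close> means having at most one edge per source, so \<open>\<M>\<^sub>n\<close> is a partition matroid
  and its bases are the transversals of the \<open>n\<close> nonempty classes of edges with common source. Hence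
  a set avoids some basis iff it contains no full class, and is the complement of a basis iff it
  misses exactly one edge of each class; the class of source \<open>i\<close> has \<open>n - i\<close> elements.
\<close>

lemma finite_with_source: "finite X \<Longrightarrow> finite (with_source X i)"
  by (simp add: with_source_def)

lemma card_with_source_chain_edges: "card (with_source (chain_edges n) i) = n - i"
proof -
  have "with_source (chain_edges n) i = Pair i ` {i<..n}"
    by (auto simp: with_source_def chain_edges_def)
  then show ?thesis by (simp add: card_image inj_on_def)
qed

text \<open>Each class of edges with common source splits into its part inside \<open>X\<close> and
  its part outside. This identity converts conditions on the complement into the cardinality
  conditions on \<open>X\<close>.\<close>

lemma card_with_source_compl:
  assumes "X \<subseteq> chain_edges n"
  shows "card (with_source X i) + card (with_source (chain_edges n - X) i) = n - i"
proof -
  have "with_source (chain_edges n) i = with_source X i \<union> with_source (chain_edges n - X) i"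
    using assms by (auto simp: with_source_def)
  moreover have "finite X" using assms finite_chain_edges by (rule finite_subset)
  moreover have "with_source X i \<inter> with_source (chain_edges n - X) i = {}"
    by (auto simp: with_source_def)
  ultimately show ?thesis
    using card_Un_disjoint[of "with_source X i" "with_source (chain_edges n - X) i"]
      card_with_source_chain_edges[of n i]
    by (simp add: finite_with_source finite_chain_edges)
qed

text \<open>Independence is injectivity of \<open>fst\<close>, so a set missing a source below
  \<open>n\<close> can be enlarged. Conversely, once all sources below \<open>n\<close> are
  attained, a further edge would repeat one of them.\<close>

lemma basis_set_transfer_matroid:
  "basis_set (transfer_matroid n) B \<longleftrightarrow>
     B \<subseteq> chain_edges n \<and> inj_on fst B \<and> fst ` B = {..<n}"
proof
  assume B: "basis_set (transfer_matroid n) B"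
  then have sub: "B \<subseteq> chain_edges n" and inj: "inj_on fst B"
    by (simp_all add: basis_set_def independent_set_def transfer_matroid_def MGS_iff_inj)
  have "i \<in> fst ` B" if "i < n" for i
  proof (rule ccontr)
    assume i: "i \<notin> fst ` B"
    \<comment> \<open>The target \<open>n\<close> is just a convenient choice: \<open>(i, n)\<close>
      is an edge for every \<open>i < n\<close>.\<close>
    then have "insert (i, n) B \<in> MGS n"
      using sub inj \<open>i < n\<close> by (auto simp: MGS_iff_inj chain_edges_def)
    then have "insert (i, n) B = B"
      using B unfolding basis_set_def independent_set_def transfer_matroid_def snd_conv by blast
    then show False using i by force
  qed
  moreover have "fst ` B \<subseteq> {..<n}" using sub by (auto simp: chain_edges_def)
  ultimately show "B \<subseteq> chain_edges n \<and> inj_on fst B \<and> fst ` B = {..<n}" using sub inj by auto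
next
  assume B: "B \<subseteq> chain_edges n \<and> inj_on fst B \<and> fst ` B = {..<n}"
  have "C = B" if C: "C \<in> MGS n" "B \<subseteq> C" for C
  proof -
    \<comment> \<open>No edge has source \<open>n\<close>, so \<open>B\<close> already attains every
      possible source; injectivity of \<open>fst\<close> on \<open>C\<close> then gives
      equality.\<close>
    have "fst ` C \<subseteq> fst ` B" using B C(1) by (auto simp: MGS_iff_inj chain_edges_def)
    then show ?thesis using C inj_on_image_eq_iff[of fst C C B] by (auto simp: MGS_iff_inj)
  qed
  then show "basis_set (transfer_matroid n) B"
    using B by (auto simp: basis_set_def independent_set_def transfer_matroid_def MGS_iff_inj)
qed

lemma basis_set_transfer_matroid_card:
  assumes "B \<subseteq> chain_edges n"
  shows "basis_set (transfer_matroid n) B \<longleftrightarrow> (\<forall>i<n. card (with_source B i) = 1)"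
proof
  assume "basis_set (transfer_matroid n) B"
  then have inj: "inj_on fst B" and img: "fst ` B = {..<n}"
    by (simp_all add: basis_set_transfer_matroid)
  show "\<forall>i<n. card (with_source B i) = 1"
  proof (intro allI impI)
    fix i assume "i < n"
    then obtain e where "e \<in> B" "fst e = i" using img by (metis imageE lessThan_iff)
    then have "with_source B i = {e}" using inj by (auto simp: with_source_def dest: inj_onD)
    then show "card (with_source B i) = 1" by simp
  qed
next
  assume card: "\<forall>i<n. card (with_source B i) = 1"
  have uniq: "\<exists>e. with_source B i = {e}" if "i < n" for i
    using card that by (simp add: card_1_singleton_iff)
  have lt: "fst e < n" if "e \<in> B" for e using that assms by (auto simp: chain_edges_def)
  have "inj_on fst B"
  proof (rule inj_onI)
    fix x y assume xy: "x \<in> B" "y \<in> B" "fst x = fst y"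
    then have "x \<in> with_source B (fst x)" "y \<in> with_source B (fst x)"
      by (simp_all add: with_source_def)
    then show "x = y" using uniq[OF lt[OF xy(1)]] by auto
  qed
  moreover have "i \<in> fst ` B" if "i < n" for i
    using uniq[OF that] by (auto simp: with_source_def)
  ultimately show "basis_set (transfer_matroid n) B"
    using assms lt by (auto simp: basis_set_transfer_matroid)
qed

text \<open>Dual independence means being disjoint from some basis. A basis disjoint from
  \<open>X\<close> amounts to a choice, for each source, of one edge outside
  \<open>X\<close>.\<close>

lemma independent_set_dual_transfer_matroid:
  assumes "X \<subseteq> chain_edges n"
  shows "independent_set (dual_matroid (transfer_matroid n)) X \<longleftrightarrow>
           (\<forall>i<n. with_source (chain_edges n - X) i \<noteq> {})"
proof
  assume "independent_set (dual_matroid (transfer_matroid n)) X"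
  then obtain B where B: "basis_set (transfer_matroid n) B" "X \<subseteq> chain_edges n - B"
    by (auto simp: independent_set_def dual_matroid_def transfer_matroid_def)
  show "\<forall>i<n. with_source (chain_edges n - X) i \<noteq> {}"
  proof (intro allI impI)
    fix i assume "i < n"
    then obtain e where "e \<in> B" "fst e = i"
      using B(1) by (metis basis_set_transfer_matroid imageE lessThan_iff)
    then have "e \<in> with_source (chain_edges n - X) i"
      using B by (auto simp: basis_set_transfer_matroid with_source_def)
    then show "with_source (chain_edges n - X) i \<noteq> {}" by blast
  qed
next
  assume "\<forall>i<n. with_source (chain_edges n - X) i \<noteq> {}"
  \<comment> \<open>The bound \<open>i < n\<close> moves under the existential quantifier so that a
    total choice function \<open>f\<close> can be extracted; its image of \<open>{..<n}\<close> is
    the required basis.\<close>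
  then have "\<forall>i. \<exists>e. i < n \<longrightarrow> e \<in> chain_edges n - X \<and> fst e = i"
    by (fastforce simp: with_source_def)
  then obtain f where f: "\<And>i. i < n \<Longrightarrow> f i \<in> chain_edges n - X \<and> fst (f i) = i"
    by metis
  have "basis_set (transfer_matroid n) (f ` {..<n})"
    unfolding basis_set_transfer_matroid using f by (auto simp: inj_on_def image_image)
  moreover have "X \<subseteq> chain_edges n - f ` {..<n}" using f assms by auto
  ultimately show "independent_set (dual_matroid (transfer_matroid n)) X"
    by (auto simp: independent_set_def dual_matroid_def transfer_matroid_def)
qed

theorem theorem3p5:
  fixes n :: nat and X :: "(nat \<times> nat) set"
  assumes "X \<subseteq> chain_edges n"
  shows "(independent_set (dual_matroid (transfer_matroid n)) X \<longleftrightarrow>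
            (\<forall>i. 0 \<le> i \<and> i < n \<longrightarrow> card (with_source X i) < n - i)) \<and>
         (basis_set (dual_matroid (transfer_matroid n)) X \<longleftrightarrow>
            (\<forall>i. 0 \<le> i \<and> i < n \<longrightarrow> card (with_source X i) = n - i - 1))"
proof -
  let ?Y = "chain_edges n - X"
  have add: "card (with_source X i) + card (with_source ?Y i) = n - i" for i
    using assms by (rule card_with_source_compl)
  have "with_source ?Y i \<noteq> {} \<longleftrightarrow> card (with_source X i) < n - i" for i
  proof -
    have "with_source ?Y i \<noteq> {} \<longleftrightarrow> card (with_source ?Y i) > 0"
      by (simp add: card_gt_0_iff finite_with_source finite_chain_edges)
    then show ?thesis using add[of i] by linarith
  qed
  moreover have "basis_set (dual_matroid (transfer_matroid n)) X \<longleftrightarrow>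
      basis_set (transfer_matroid n) ?Y"
  proof -
    \<comment> \<open>Complementation within the ground set is an involution, so \<open>?Y\<close>
      is the only basis whose complement can be \<open>X\<close>.\<close>
    have "X = fst (transfer_matroid n) - B \<longleftrightarrow> B = ?Y" if "basis_set (transfer_matroid n) B" for B
    proof -
      have "B \<subseteq> chain_edges n" using that by (simp add: basis_set_transfer_matroid)
      then show ?thesis using assms by (auto simp: transfer_matroid_def)
    qed
    then show ?thesis by (metis basis_set_dual matroid_transfer_matroid)
  qed
  \<comment> \<open>The guard \<open>i < n\<close> matters: beyond it both classes are empty, and
    truncated subtraction would make only the right side true.\<close>
  moreover have "card (with_source ?Y i) = 1 \<longleftrightarrow> card (with_source X i) = n - i - 1" if "i < n" for i
    using add[of i] that by linarith
  ultimately show ?thesis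
    using assms by (simp add: independent_set_dual_transfer_matroid basis_set_transfer_matroid_card)
qed

end
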